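(* Let $A$ and $B$ be two square complex matrices, each of order greater than $1$. Then $A\wr B=B\wr A$ if and only if $A$ and $B$ have the same order and differ by a multiple of the identity matrix (i.e. $A-B=hI$ for some $h\in\mathbb{C}$).
   Context: Wreath product of matrices: for $A\in\mathcal{M}_n(\mathbb{C})$ and $B\in\mathcal{M}_m(\mathbb{C})$, $$A\wr B = I_m^{\otimes n}\otimes A+\sum_{i=1}^n I_m^{\otimes (i-1)}\otimes B\otimes I_m^{\otimes (n-i)}\otimes C_i,$$ a square matrix of order $nm^n$. Here $\otimes$ is the Kronecker product, $I_m^{\otimes r}$ is the $r$-fold Kronecker power, with $I_m^{\otimes 0}=1$, and $C_i\in\mathcal{M}_n(\mathbb{C})$ has entry $1$ in position $(i,i)$ and $0$ elsewhere. The equality $A\wr B=B\wr A$ includes the requirement that both matrices have the same order. *)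

theory Defs
  imports Complex_Main "Jordan_Normal_Form.Matrix"
begin

definition kronecker :: "'a :: semiring_1 mat \<Rightarrow> 'a mat \<Rightarrow> 'a mat"  (infixl \<open>\<otimes>\<^sub>m\<close> 70) where
  "A \<otimes>\<^sub>m B = mat (dim_row A * dim_row B) (dim_col A * dim_col B)
     (\<lambda>(i, j). A $$ (i div dim_row B, j div dim_col B) * B $$ (i mod dim_row B, j mod dim_col B))"

primrec kronecker_power :: "'a :: semiring_1 mat \<Rightarrow> nat \<Rightarrow> 'a mat"  (infixr \<open>^\<^sub>\<otimes>\<close> 80) where
  "A ^\<^sub>\<otimes> 0 = 1\<^sub>m 1"
| "A ^\<^sub>\<otimes> (Suc r) = A \<otimes>\<^sub>m (A ^\<^sub>\<otimes> r)"

text \<open>Indices are zero-based, so \<open>diag_unit_mat n i\<close> is $C_{i+1}$.\<close>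

definition diag_unit_mat :: "nat \<Rightarrow> nat \<Rightarrow> 'a :: semiring_1 mat" where
  "diag_unit_mat n i = mat n n (\<lambda>(r, c). if r = i \<and> c = i then 1 else 0)"

text \<open>For fixed dimensions matrices form an additive monoid, but the type of matrices of all
  dimensions does not; hence the sum over \<open>i < n\<close> is a fold starting from the zero matrix of
  order $n m^n$. The definition is meant for square \<open>A\<close> and \<open>B\<close>, of orders \<open>n\<close> and \<open>m\<close>.\<close>

definition wreath_mat :: "'a :: semiring_1 mat \<Rightarrow> 'a mat \<Rightarrow> 'a mat"  (infixl \<open>\<wr>\<^sub>m\<close> 70) where
  "A \<wr>\<^sub>m B =
    (let n = dim_row A; m = dim_row B in
      (1\<^sub>m m ^\<^sub>\<otimes> n) \<otimes>\<^sub>m A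
      + foldr (+)
          (map (\<lambda>i. (1\<^sub>m m ^\<^sub>\<otimes> i) \<otimes>\<^sub>m B \<otimes>\<^sub>m (1\<^sub>m m ^\<^sub>\<otimes> (n - Suc i)) \<otimes>\<^sub>m diag_unit_mat n i) [0..<n])
          (0\<^sub>m (n * m ^ n) (n * m ^ n)))"

lemma kronecker_carrier:
  assumes "A \<in> carrier_mat a b" and "B \<in> carrier_mat c d"
  shows "A \<otimes>\<^sub>m B \<in> carrier_mat (a * c) (b * d)"
  using assms by (auto simp: kronecker_def)

lemma kronecker_power_carrier:
  assumes "A \<in> carrier_mat a b"
  shows "A ^\<^sub>\<otimes> r \<in> carrier_mat (a ^ r) (b ^ r)"
  using assms by (induction r) (auto intro: kronecker_carrier)

text \<open>Each summand of the fold has order $n m^n$, so no dimension mismatch occurs in the sum.\<close>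

lemma wreath_mat_summand_carrier:
  assumes "B \<in> carrier_mat m m" and "i < n"
  shows "(1\<^sub>m m ^\<^sub>\<otimes> i) \<otimes>\<^sub>m B \<otimes>\<^sub>m (1\<^sub>m m ^\<^sub>\<otimes> (n - Suc i)) \<otimes>\<^sub>m diag_unit_mat n i
    \<in> carrier_mat (n * m ^ n) (n * m ^ n)"
proof -
  have "m ^ i * m * m ^ (n - Suc i) = m ^ (i + 1 + (n - Suc i))"
    by (simp add: power_add)
  then have e: "m ^ i * m * m ^ (n - Suc i) * n = n * m ^ n"
    using assms(2) by simp
  have p: "1\<^sub>m m ^\<^sub>\<otimes> r \<in> carrier_mat (m ^ r) (m ^ r)" for r
    by (rule kronecker_power_carrier) simp
  have d: "diag_unit_mat n i \<in> carrier_mat n n"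
    by (simp add: diag_unit_mat_def)
  show ?thesis
    using kronecker_carrier[OF kronecker_carrier[OF kronecker_carrier[OF p[of i] assms(1)] p[of "n - Suc i"]] d]
    unfolding e .
qed

lemma wreath_mat_carrier:
  assumes "A \<in> carrier_mat n n" and "B \<in> carrier_mat m m"
  shows "A \<wr>\<^sub>m B \<in> carrier_mat (n * m ^ n) (n * m ^ n)"
proof -
  have "foldr (+) (map f xs) (0\<^sub>m N N) \<in> carrier_mat N N"
    if "\<And>i. i \<in> set xs \<Longrightarrow> f i \<in> carrier_mat N N" for f :: "nat \<Rightarrow> 'a mat" and xs N
    using that by (induction xs) auto
  from this[of "[0..<n]", OF wreath_mat_summand_carrier[OF assms(2)]]
  show ?thesis
    using assms by (auto simp: wreath_mat_def Let_def)
qed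

end

theory Submission
  imports Defs
begin

text \<open>
  Index the rows and columns of \<open>A \<wr>\<^sub>m B\<close> by pairs \<open>(x, i)\<close>, where \<open>i < n\<close> and \<open>x < m ^ n\<close> is read as
  a word of \<open>n\<close> digits in base \<open>m\<close>, the most significant digit being number \<open>0\<close>. The entry at
  \<open>((x, i), (y, j))\<close> is $[x = y] A_{ij} + [i = j] B_{x_i y_i}$, the second term being present only if
  \<open>x\<close> and \<open>y\<close> agree in all digits other than the \<open>i\<close>-th. Equality of orders amounts to
  $m^{n-1} = n^{m-1}$, which forces \<open>n = m\<close>. With \<open>D = A - B\<close>, commutation then says that
  $[x = y] D_{ij}$ equals $[i = j] D_{x_i y_i}$ (with the same proviso): \<open>x = y\<close> and \<open>i \<noteq> j\<close> makes \<open>D\<close>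
  diagonal, and \<open>x = y\<close> and \<open>i = j\<close>, with an arbitrary digit $x_i$, makes \<open>D\<close> scalar.
\<close>

section \<open>Entries of wreath products\<close>

lemma kronecker_dim [simp]:
  "dim_row (A \<otimes>\<^sub>m B) = dim_row A * dim_row B" "dim_col (A \<otimes>\<^sub>m B) = dim_col A * dim_col B"
  by (simp_all add: kronecker_def)

lemma kronecker_index:
  assumes "i < dim_row A * dim_row B" and "j < dim_col A * dim_col B"
  shows "(A \<otimes>\<^sub>m B) $$ (i, j) =
    A $$ (i div dim_row B, j div dim_col B) * B $$ (i mod dim_row B, j mod dim_col B)"
  using assms by (simp add: kronecker_def)

lemma div_mod_eq_iff: "i div k = j div k \<and> i mod k = j mod k \<longleftrightarrow> i = j" for i j k :: nat
  by (metis div_mult_mod_eq)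

lemma mod_less_of_less_mult: "i < a * b \<Longrightarrow> i mod b < b" for i a b :: nat
  by (cases "b = 0") auto

lemma kronecker_one_one: "1\<^sub>m a \<otimes>\<^sub>m 1\<^sub>m b = (1\<^sub>m (a * b) :: 'a :: semiring_1 mat)"
proof (rule eq_matI)
  fix i j assume "i < dim_row (1\<^sub>m (a * b) :: 'a mat)" "j < dim_col (1\<^sub>m (a * b) :: 'a mat)"
  then show "(1\<^sub>m a \<otimes>\<^sub>m 1\<^sub>m b) $$ (i, j) = (1\<^sub>m (a * b) :: 'a mat) $$ (i, j)"
    using div_mod_eq_iff[of i b j]
    by (auto simp: kronecker_index less_mult_imp_div_less mod_less_of_less_mult)
qed simp_all

lemma kronecker_power_one: "1\<^sub>m m ^\<^sub>\<otimes> r = (1\<^sub>m (m ^ r) :: 'a :: semiring_1 mat)"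
  by (induction r) (simp_all add: kronecker_one_one)

text \<open>The carrier claim accompanies the entry formula because an entry of a sum splits only at
  positions inside the second summand, here the rest of the fold.\<close>

lemma foldr_add_mat_index:
  assumes "\<And>i. i \<in> set xs \<Longrightarrow> f i \<in> carrier_mat a b" and "r < a" and "c < b"
  shows "foldr (+) (map f xs) (0\<^sub>m a b) \<in> carrier_mat a b"
    and "foldr (+) (map f xs) (0\<^sub>m a b) $$ (r, c) = (\<Sum>i\<leftarrow>xs. f i $$ (r, c))"
  using assms(1) by (induction xs) (use assms(2,3) in auto)

text \<open>In a word of \<open>i + 1 + k\<close> digits in base \<open>m\<close>, digit \<open>i\<close> has place value \<open>m ^ k\<close>.\<close>

lemma wreath_mat_factor_index:
  fixes B :: "'a :: semiring_1 mat"
  assumes "B \<in> carrier_mat m m" and "x < m ^ (i + 1 + k)" and "y < m ^ (i + 1 + k)"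
  shows "((1\<^sub>m m ^\<^sub>\<otimes> i) \<otimes>\<^sub>m B \<otimes>\<^sub>m (1\<^sub>m m ^\<^sub>\<otimes> k)) $$ (x, y) =
    (if x div m ^ k div m = y div m ^ k div m \<and> x mod m ^ k = y mod m ^ k
     then B $$ (x div m ^ k mod m, y div m ^ k mod m) else 0)"
proof -
  have xy: "x < m ^ i * m * m ^ k" "y < m ^ i * m * m ^ k"
    using assms(2,3) by (simp_all add: power_add mult_ac)
  then have q: "x div m ^ k < m ^ i * m" "y div m ^ k < m ^ i * m"
    by (auto intro: less_mult_imp_div_less)
  then have "x div m ^ k div m < m ^ i" "y div m ^ k div m < m ^ i"
    by (auto intro: less_mult_imp_div_less)
  then show ?thesis
    using assms(1) xy q mod_less_of_less_mult[OF xy(1)] mod_less_of_less_mult[OF xy(2)]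
    by (simp add: kronecker_power_one kronecker_index)
qed

text \<open>The Kronecker factor of order \<open>n\<close> comes last, so the pair
  \<open>(x, i)\<close> sits at \<open>x * n + i\<close>. With \<open>k\<close> digits after digit
  \<open>i\<close>, the conditions compare the digits before and after it, and \<open>B\<close> is
  read at digit \<open>i\<close> itself. The factor \<open>diag_unit_mat n l\<close> leaves only the
  summand with \<open>l = i = j\<close>.\<close>

lemma wreath_mat_index:
  fixes A B :: "'a :: semiring_1 mat"
  assumes A: "A \<in> carrier_mat n n" and B: "B \<in> carrier_mat m m"
    and x: "x < m ^ n" and y: "y < m ^ n" and i: "i < n" and j: "j < n"
    and k: "k = n - Suc i"
  shows "(A \<wr>\<^sub>m B) $$ (x * n + i, y * n + j) =
    (if x = y then A $$ (i, j) else 0) +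
    (if i = j \<and> x div m ^ k div m = y div m ^ k div m \<and> x mod m ^ k = y mod m ^ k
     then B $$ (x div m ^ k mod m, y div m ^ k mod m) else 0)"
proof -
  let ?r = "x * n + i" and ?c = "y * n + j"
  define F :: "nat \<Rightarrow> 'a mat" where
    "F l = (1\<^sub>m m ^\<^sub>\<otimes> l) \<otimes>\<^sub>m B \<otimes>\<^sub>m (1\<^sub>m m ^\<^sub>\<otimes> (n - Suc l))" for l
  define S where "S l = F l \<otimes>\<^sub>m diag_unit_mat n l" for l
  have less: "z * n + l < m ^ n * n" if "z < m ^ n" "l < n" for z l
  proof -
    have "z * n + l < Suc z * n" using that by simp
    also have "\<dots> \<le> m ^ n * n" using that by (intro mult_right_mono) auto
    finally show ?thesis .
  qed
  have r: "?r < m ^ n * n" and c: "?c < m ^ n * n"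
    using less x y i j by blast+
  have S: "S l \<in> carrier_mat (n * m ^ n) (n * m ^ n)" if "l < n" for l
    unfolding S_def F_def by (rule wreath_mat_summand_carrier[OF B that])
  \<comment> \<open>Obtained from the order of \<open>S l\<close> by cancelling the positive factor
    \<open>n\<close>.\<close>
  have dF: "dim_row (F l) = m ^ n" "dim_col (F l) = m ^ n" if "l < n" for l
    using S[OF that] that by (auto simp: S_def diag_unit_mat_def)
  have Sent: "S l $$ (?r, ?c) = (if l = i then if i = j then F i $$ (x, y) else 0 else 0)"
    if "l < n" for l
    using r c i j dF[OF that] by (auto simp: S_def kronecker_index diag_unit_mat_def)
  have Fent: "F i $$ (x, y) =
      (if x div m ^ k div m = y div m ^ k div m \<and> x mod m ^ k = y mod m ^ k
       then B $$ (x div m ^ k mod m, y div m ^ k mod m) else 0)"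
    unfolding F_def k by (rule wreath_mat_factor_index[OF B]) (use x y i in auto)
  have fold: "foldr (+) (map S [0..<n]) (0\<^sub>m (n * m ^ n) (n * m ^ n)) \<in> carrier_mat (n * m ^ n) (n * m ^ n)"
    "foldr (+) (map S [0..<n]) (0\<^sub>m (n * m ^ n) (n * m ^ n)) $$ (?r, ?c) = (\<Sum>l\<leftarrow>[0..<n]. S l $$ (?r, ?c))"
    using r c S by (auto intro!: foldr_add_mat_index simp: mult.commute)
  have "(\<Sum>l\<leftarrow>[0..<n]. S l $$ (?r, ?c)) = (\<Sum>l<n. S l $$ (?r, ?c))"
    by (simp add: interv_sum_list_conv_sum_set_nat atLeast0LessThan)
  also have "\<dots> = (\<Sum>l<n. if l = i then if i = j then F i $$ (x, y) else 0 else 0)"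
    by (intro sum.cong) (use Sent in auto)
  also have "\<dots> = (if i = j then F i $$ (x, y) else 0)"
    using i by simp
  finally have sum: "(\<Sum>l\<leftarrow>[0..<n]. S l $$ (?r, ?c)) = (if i = j then F i $$ (x, y) else 0)" .
  have first: "((1\<^sub>m m ^\<^sub>\<otimes> n) \<otimes>\<^sub>m A) $$ (?r, ?c) = (if x = y then A $$ (i, j) else 0)"
    using A r c i j x y by (auto simp: kronecker_power_one kronecker_index)
  have "A \<wr>\<^sub>m B = (1\<^sub>m m ^\<^sub>\<otimes> n) \<otimes>\<^sub>m A + foldr (+) (map S [0..<n]) (0\<^sub>m (n * m ^ n) (n * m ^ n))"
    using A B by (simp add: wreath_mat_def Let_def S_def[abs_def] F_def)
  also have "\<dots> $$ (?r, ?c) = (if x = y then A $$ (i, j) else 0) + (if i = j then F i $$ (x, y) else 0)"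
    using fold r c first sum by (simp add: mult.commute)
  finally show ?thesis
    unfolding Fent by simp
qed

section \<open>Orders of wreath products\<close>

lemma Suc_power_less:
  assumes "2 \<le> m" and "m \<le> n"
  shows "Suc n ^ (m - 1) < m * n ^ (m - 1)"
proof -
  have "1 / real m < 2 / (real m + 1)"
    using assms(1) by (simp add: field_simps)
  also have "\<dots> = 1 - (real m - 1) / (real m + 1)"
    by (simp add: field_simps)
  also have "\<dots> \<le> 1 - (real m - 1) / (real n + 1)"
    using assms by (intro diff_left_mono divide_left_mono) auto
  also have "\<dots> = 1 + real (m - 1) * (- 1 / (real n + 1))"
    using assms(1) by (simp add: of_nat_diff)
  also have "\<dots> \<le> (1 + (- 1 / (real n + 1))) ^ (m - 1)"
    by (rule Bernoulli_inequality) (simp add: field_simps)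
  also have "1 + (- 1 / (real n + 1)) = real n / real (Suc n)"
    by (simp add: field_simps)
  finally have "1 / real m < real n ^ (m - 1) / real (Suc n) ^ (m - 1)"
    by (simp add: power_divide)
  then have "real (Suc n) ^ (m - 1) < real m * real n ^ (m - 1)"
    using assms(1) by (simp add: field_simps del: of_nat_Suc)
  then have "real (Suc n ^ (m - 1)) < real (m * n ^ (m - 1))"
    by simp
  then show ?thesis
    by (simp only: of_nat_less_iff)
qed

text \<open>Induction from \<open>n = m + 1\<close>: raising \<open>n\<close> by one multiplies the
  right side by \<open>m\<close> and the left side by less than \<open>m\<close>. The base case is
  the previous bound at \<open>n = m\<close>.\<close>

lemma power_pred_less:
  assumes "2 \<le> m" and "m < n"
  shows "n ^ (m - 1) < m ^ (n - 1)"
proof -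
  from assms(2) have "Suc m \<le> n" by simp
  then show ?thesis
  proof (induction n rule: nat_induct_at_least)
    case base
    then show ?case
      using Suc_power_less[OF assms(1) order_refl] assms(1) power_eq_if[of m m] by simp
  next
    case (Suc n)
    have "Suc n ^ (m - 1) < m * n ^ (m - 1)"
      by (rule Suc_power_less) (use assms(1) Suc.hyps in auto)
    also have "\<dots> \<le> m * m ^ (n - 1)"
      using Suc.IH by simp
    also have "\<dots> = m ^ (Suc n - 1)"
      using Suc.hyps power_eq_if[of m n] by simp
    finally show ?case .
  qed
qed

lemma wreath_order_eq_imp_eq:
  fixes m n :: nat
  assumes "n * m ^ n = m * n ^ m" and "1 < n" and "1 < m"
  shows "n = m"
proof -
  have "n * (m * m ^ (n - 1)) = m * (n * n ^ (m - 1))"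
    using assms power_eq_if[of m n] power_eq_if[of n m] by simp
  then have "m ^ (n - 1) = n ^ (m - 1)"
    using assms(2,3) by simp
  then show ?thesis
    using power_pred_less[of m n] power_pred_less[of n m] assms(2,3) by (cases n m rule: linorder_cases) auto
qed

section \<open>Commuting wreath products\<close>

lemma wreath_mat_commute_imp_scalar_diff:
  fixes A B :: "'a :: ring_1 mat"
  assumes A: "A \<in> carrier_mat n n" and B: "B \<in> carrier_mat n n" and "0 < n"
    and eq: "A \<wr>\<^sub>m B = B \<wr>\<^sub>m A"
  shows "A - B = (A $$ (0, 0) - B $$ (0, 0)) \<cdot>\<^sub>m 1\<^sub>m n"
proof (rule eq_matI)
  fix i j assume "i < dim_row ((A $$ (0, 0) - B $$ (0, 0)) \<cdot>\<^sub>m 1\<^sub>m n)"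
    and "j < dim_col ((A $$ (0, 0) - B $$ (0, 0)) \<cdot>\<^sub>m 1\<^sub>m n)"
  then have i: "i < n" and j: "j < n" by simp_all
  show "(A - B) $$ (i, j) = ((A $$ (0, 0) - B $$ (0, 0)) \<cdot>\<^sub>m 1\<^sub>m n) $$ (i, j)"
  proof (cases "i = j")
    case False
    \<comment> \<open>Both words are 0; since \<open>i\<close> and \<open>j\<close> differ, only the
      first term of each entry survives.\<close>
    have "0 < n ^ n" using \<open>0 < n\<close> by simp
    from wreath_mat_index[OF A B this this i j refl] wreath_mat_index[OF B A this this i j refl]
    have "A $$ (i, j) = B $$ (i, j)"
      using eq False by simp
    then show ?thesis
      using A B i j False by simp
  next
    case True
    \<comment> \<open>The word with leading digit \<open>i\<close> and zeros elsewhere: its diagonal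
      entry in block position 0 pairs the entry at \<open>(0, 0)\<close> of one matrix with that at
      \<open>(i, i)\<close> of the other.\<close>
    let ?x = "i * n ^ (n - 1)"
    have "?x < n * n ^ (n - 1)" using i \<open>0 < n\<close> by simp
    then have x: "?x < n ^ n" using \<open>0 < n\<close> power_eq_if[of n n] by simp
    from wreath_mat_index[OF A B x x \<open>0 < n\<close> \<open>0 < n\<close> refl]
      wreath_mat_index[OF B A x x \<open>0 < n\<close> \<open>0 < n\<close> refl]
    have "A $$ (0, 0) + B $$ (i, i) = B $$ (0, 0) + A $$ (i, i)"
      using eq i \<open>0 < n\<close> by simp
    then have "A $$ (i, i) - B $$ (i, i) = A $$ (0, 0) - B $$ (0, 0)"
      by (simp add: algebra_simps)
    then show ?thesis
      using A B i j True by simp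
  qed
qed (use B in auto)

text \<open>Writing \<open>A\<close> as \<open>B\<close> plus \<open>h\<close> times the identity,
  \<open>h\<close> enters one product through the first term and the other through the digit term,
  in both cases exactly when \<open>x = y\<close> and \<open>i = j\<close>.\<close>

lemma wreath_mat_commute_if_scalar_diff:
  fixes A B :: "'a :: ring_1 mat"
  assumes A: "A \<in> carrier_mat n n" and B: "B \<in> carrier_mat n n"
    and diff: "A - B = h \<cdot>\<^sub>m 1\<^sub>m n"
  shows "A \<wr>\<^sub>m B = B \<wr>\<^sub>m A"
proof (rule eq_matI)
  have AB: "A $$ (i, j) = B $$ (i, j) + (if i = j then h else 0)" if "i < n" "j < n" for i j
  proof -
    have "A $$ (i, j) - B $$ (i, j) = (A - B) $$ (i, j)"
      using A B that by simp
    also have "\<dots> = (if i = j then h else 0)"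
      unfolding diff using that by simp
    finally show ?thesis by (simp add: algebra_simps)
  qed
  fix r c assume "r < dim_row (B \<wr>\<^sub>m A)" "c < dim_col (B \<wr>\<^sub>m A)"
  then have rc: "r < n ^ n * n" "c < n ^ n * n"
    using wreath_mat_carrier[OF B A] by (simp_all add: mult.commute)
  then have n: "0 < n" by (cases n) auto
  define x y i j where "x = r div n" and "y = c div n" and "i = r mod n" and "j = c mod n"
  have r: "r = x * n + i" and c: "c = y * n + j"
    by (simp_all add: x_def y_def i_def j_def)
  have bounds: "x < n ^ n" "y < n ^ n" "i < n" "j < n"
    using rc n by (auto simp: x_def y_def i_def j_def less_mult_imp_div_less)
  let ?k = "n - Suc i"
  \<comment> \<open>Words agreeing before, after and at digit \<open>i\<close> are equal, so the
    digit term sees \<open>h\<close> only on the diagonal.\<close>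
  have agree: "x div n ^ ?k div n = y div n ^ ?k div n \<and> x mod n ^ ?k = y mod n ^ ?k
      \<and> x div n ^ ?k mod n = y div n ^ ?k mod n \<longleftrightarrow> x = y"
    by (metis div_mod_eq_iff)
  show "(A \<wr>\<^sub>m B) $$ (r, c) = (B \<wr>\<^sub>m A) $$ (r, c)"
    unfolding r c wreath_mat_index[OF A B bounds refl] wreath_mat_index[OF B A bounds refl]
    using AB[OF bounds(3,4)] AB[of "x div n ^ ?k mod n" "y div n ^ ?k mod n"] n agree
    by (auto simp: algebra_simps)
qed (use wreath_mat_carrier[OF A B] wreath_mat_carrier[OF B A] in auto)

theorem corollary4p3:
  fixes A B :: "complex mat" and n m :: nat
  assumes "A \<in> carrier_mat n n" and "B \<in> carrier_mat m m"
    and "n > 1" and "m > 1"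
  shows "A \<wr>\<^sub>m B = B \<wr>\<^sub>m A \<longleftrightarrow> n = m \<and> (\<exists>h :: complex. A - B = h \<cdot>\<^sub>m 1\<^sub>m n)"
proof
  assume eq: "A \<wr>\<^sub>m B = B \<wr>\<^sub>m A"
  have "n * m ^ n = m * n ^ m"
    using wreath_mat_carrier[OF assms(1,2)] wreath_mat_carrier[OF assms(2,1)] eq by auto
  then have "n = m"
    using assms(3,4) by (rule wreath_order_eq_imp_eq)
  then show "n = m \<and> (\<exists>h. A - B = h \<cdot>\<^sub>m 1\<^sub>m n)"
    using wreath_mat_commute_imp_scalar_diff[of A n B] assms eq by auto
next
  assume "n = m \<and> (\<exists>h. A - B = h \<cdot>\<^sub>m 1\<^sub>m n)"
  then show "A \<wr>\<^sub>m B = B \<wr>\<^sub>m A"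
    using wreath_mat_commute_if_scalar_diff assms(1,2) by blast
qed

end
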